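(* For every integer $n \geq 1$, $$\operatorname{Cat}_{B_n}(q) = \operatorname{Cat}_n(q) + \sum_{k=0}^{n-1} q^{2k+1}\, \operatorname{Cat}_{B_k}(q)\, \operatorname{Cat}_{n-k}(q),$$ where $\operatorname{Cat}_{B_0}(q) = 1$.
   Context: A unit square means a square $[a,a+1]\times[b,b+1]$ with $a,b$ nonnegative integers. Lattice paths use unit north steps $(0,1)$ and east steps $(1,0)$. Type $A$: for $n\ge 1$, a Catalan (Dyck) path of length $n$ is a lattice path from $(0,0)$ to $(n,n)$ with $n$ north and $n$ east steps that never goes below the line $y=x$. Its area is the number of unit squares lying entirely in the region between the path and the line $y=x$ (squares cut in half by $y=x$ are not counted). Set $\operatorname{Cat}_n(q) = \sum_{\lambda} q^{\operatorname{area}(\lambda)}$, the sum over all Catalan paths of length $n$, and $\operatorname{Cat}_0(q)=1$. Type $B$: for $n \geq 1$, a type $B$ Catalan path of length $n$ is a lattice path of $2n$ steps, each north or east, starting at $(0,0)$ and never going below the line $y=x$ (its endpoint lies on the line $x+y=2n$). Its area $\operatorname{area}(\lambda)$ is the number of unit squares in the region bounded by the path, the diagonal $y=x$ and the anti-diagonal $x+y=2n$, where the half-squares cut by the diagonal $y=x$ are not counted but the half-squares cut by the anti-diagonal $x+y=2n$ are counted. Set $\operatorname{Cat}_{B_n}(q) = \sum_\lambda q^{\operatorname{area}(\lambda)}$, the sum over all type $B$ Catalan paths of length $n$, and $\operatorname{Cat}_{B_0}(q)=1$. (For example $\operatorname{Cat}_{B_2}(q)=1+2q+q^2+q^3+q^4$.)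 *)

theory Defs
  imports Complex_Main "HOL-Computational_Algebra.Polynomial"
begin

datatype step = North | East

text \<open>A lattice path is given by its list of steps, starting at \<open>(0,0)\<close>.\<close>

definition vertex :: "step list \<Rightarrow> nat \<Rightarrow> nat \<times> nat" where
  "vertex p k = (count_list (take k p) East, count_list (take k p) North)"

definition vertices :: "step list \<Rightarrow> (nat \<times> nat) set" where
  "vertices p = vertex p ` {..length p}"

definition never_below_diagonal :: "step list \<Rightarrow> bool" where
  "never_below_diagonal p \<longleftrightarrow> (\<forall>(i, j)\<in>vertices p. i \<le> j)"

definition catalan_paths :: "nat \<Rightarrow> step list set" where
  "catalan_paths n =
     {p. count_list p North = n \<and> count_list p East = n \<and> never_below_diagonal p}"

definition catalan_paths_B :: "nat \<Rightarrow> step list set" where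
  "catalan_paths_B n = {p. length p = 2 * n \<and> never_below_diagonal p}"

definition unit_square :: "nat \<Rightarrow> nat \<Rightarrow> (real \<times> real) set" where
  "unit_square a b = {real a..real a + 1} \<times> {real b..real b + 1}"

text \<open>The points weakly to the south-east of the path and weakly above the line \<open>y = x\<close>.
  As the steps go north and east, a point lies weakly to the south-east of some point of the
  path if and only if it does so for some lattice point of the path.\<close>

definition region :: "step list \<Rightarrow> (real \<times> real) set" where
  "region p = {(x, y). x \<le> y \<and> (\<exists>(i, j)\<in>vertices p. real i \<le> x \<and> y \<le> real j)}"

text \<open>A square cut in half by \<open>y = x\<close> is not contained in the region, hence not counted.\<close>

definition area :: "step list \<Rightarrow> nat" where
  "area p = card {(a, b). unit_square a b \<subseteq> region p}"

definition below_antidiagonal :: "nat \<Rightarrow> (real \<times> real) set" where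
  "below_antidiagonal n = {(x, y). x + y \<le> 2 * real n}"

definition region_B :: "nat \<Rightarrow> step list \<Rightarrow> (real \<times> real) set" where
  "region_B n p = region p \<inter> below_antidiagonal n"

text \<open>The line \<open>x + y = 2 * n\<close> cuts the unit square at \<open>(a, b)\<close> in half if and only if
  \<open>a + b + 1 = 2 * n\<close>; such a square counts if its lower half is contained in the region.\<close>

definition area_B :: "nat \<Rightarrow> step list \<Rightarrow> nat" where
  "area_B n p = card {(a, b). unit_square a b \<subseteq> region_B n p \<or>
     (a + b + 1 = 2 * n \<and> unit_square a b \<inter> below_antidiagonal n \<subseteq> region_B n p)}"

text \<open>The polynomials in \<open>q\<close>. For \<open>n = 0\<close> both sums range over the empty path only, which gives
  the usual convention \<open>Cat 0 = Cat_B 0 = 1\<close>.\<close>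

definition Cat :: "nat \<Rightarrow> int poly" where
  "Cat n = (\<Sum>p\<in>catalan_paths n. monom 1 (area p))"

definition Cat_B :: "nat \<Rightarrow> int poly" where
  "Cat_B n = (\<Sum>p\<in>catalan_paths_B n. monom 1 (area_B n p))"

lemma region_Nil: "region [] = {(0, 0)}"
  by (auto simp: region_def vertices_def vertex_def)

lemma not_unit_square_subset_origin: "\<not> unit_square a b \<subseteq> {(0, 0)}"
proof
  assume "unit_square a b \<subseteq> {(0, 0)}"
  moreover have "(real a + 1, real b) \<in> unit_square a b"
    by (simp add: unit_square_def)
  ultimately show False
    by auto
qed

lemma Cat_0: "Cat 0 = 1"
proof -
  have "catalan_paths 0 = {[]}"
  proof -
    have "p = []" if "count_list p North = 0" "count_list p East = 0" for p
      using that by (cases p; cases "hd p") auto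
    then show ?thesis
      by (auto simp: catalan_paths_def never_below_diagonal_def vertices_def vertex_def)
  qed
  then show ?thesis
    by (simp add: Cat_def area_def region_Nil not_unit_square_subset_origin)
qed

lemma Cat_B_0: "Cat_B 0 = 1"
proof -
  have "catalan_paths_B 0 = {[]}"
    by (auto simp: catalan_paths_B_def never_below_diagonal_def vertices_def vertex_def)
  moreover have "region_B 0 [] = {(0, 0)}"
    by (auto simp: region_B_def region_Nil below_antidiagonal_def)
  ultimately show ?thesis
    by (simp add: Cat_B_def area_B_def not_unit_square_subset_origin)
qed

end

theory Submission
  imports Defs
begin

text \<open>A type B path that does not end on the diagonal ends at height \<open>y - x \<ge> 2\<close>. Cut it at its
  last north step from height 1 to height 2, as \<open>c @ North # s\<close>. Then \<open>c @ [East]\<close> is a Catalan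
  path of length \<open>n - k\<close> with the same area as \<open>c\<close>, and \<open>s\<close> stays weakly above its starting point,
  so it is a type B path of length \<open>k\<close>. The cut step and raising \<open>s\<close> by 2 contribute \<open>q ^ (2 * k + 1)\<close>.\<close>

section \<open>Heights and weights of step words\<close>

definition height :: "step list \<Rightarrow> int" where
  "height p = int (count_list p North) - int (count_list p East)"

lemma height_simps [simp]:
  "height [] = 0" "height (North # p) = 1 + height p" "height (East # p) = height p - 1"
  "height (p @ q) = height p + height q"
  by (auto simp: height_def)

lemma length_eq_count_steps: "length p = count_list p North + count_list p East"
proof (induction p)
  case (Cons x p)
  then show ?case by (cases x) auto
qed auto

text \<open>The starting height \<open>d\<close> is a parameter so that the pieces of a cut path can
  be treated on their own.\<close>

fun nonneg_from :: "int \<Rightarrow> step list \<Rightarrow> bool" where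
  "nonneg_from d [] \<longleftrightarrow> 0 \<le> d"
| "nonneg_from d (North # p) \<longleftrightarrow> 0 \<le> d \<and> nonneg_from (d + 1) p"
| "nonneg_from d (East # p) \<longleftrightarrow> 0 \<le> d \<and> nonneg_from (d - 1) p"

lemma nonneg_from_start: "nonneg_from d p \<Longrightarrow> 0 \<le> d"
  by (cases "(d, p)" rule: nonneg_from.cases) auto

lemma nonneg_from_append:
  "nonneg_from d (p @ q) \<longleftrightarrow> nonneg_from d p \<and> nonneg_from (d + height p) q"
  by (induction d p rule: nonneg_from.induct)
    (auto simp: add.assoc diff_add_eq add_diff_eq dest: nonneg_from_start)

lemma nonneg_from_end: "nonneg_from d p \<Longrightarrow> 0 \<le> d + height p"
  using nonneg_from_append[of d p "[]"] by simp

lemma nonneg_from_mono: "nonneg_from d p \<Longrightarrow> d \<le> e \<Longrightarrow> nonneg_from e p"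
  by (induction d p arbitrary: e rule: nonneg_from.induct) auto

text \<open>The weight adds up the heights at which north steps start: such a step from \<open>(i, j)\<close> adds
  the squares \<open>(i, j), ..., (j - 1, j)\<close> to those dominated by the path.\<close>

fun weight :: "int \<Rightarrow> step list \<Rightarrow> int" where
  "weight d [] = 0"
| "weight d (North # p) = d + weight (d + 1) p"
| "weight d (East # p) = weight (d - 1) p"

lemma weight_append: "weight d (p @ q) = weight d p + weight (d + height p) q"
  by (induction d p rule: weight.induct) (auto simp: add.assoc diff_add_eq add_diff_eq)

text \<open>Every north step starts \<open>e\<close> higher. The case \<open>e = 2\<close> handles
  the part of a path after the cut.\<close>

lemma weight_shift: "weight (d + e) p = weight d p + e * int (count_list p North)"
proof (induction d p rule: weight.induct)
  case (2 d p)
  have "weight (d + e + 1) p = weight (d + 1 + e) p"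
    by (simp add: ac_simps)
  with 2 show ?case by (simp add: algebra_simps)
next
  case (3 d p)
  have "weight (d + e - 1) p = weight (d - 1 + e) p"
    by (simp add: algebra_simps)
  with 3 show ?case by simp
qed auto

section \<open>Lattice vertices and the unit squares dominated by a path\<close>

lemma vertices_Nil: "vertices [] = {(0, 0)}"
  by (simp add: vertices_def vertex_def)

lemma vertices_snoc:
  "vertices (p @ [x]) =
     insert (count_list (p @ [x]) East, count_list (p @ [x]) North) (vertices p)"
proof -
  have "vertex (p @ [x]) ` {..length p} = vertex p ` {..length p}"
    by (intro image_cong) (auto simp: vertex_def)
  then show ?thesis
    by (simp add: vertices_def atMost_Suc vertex_def)
qed

lemma never_below_diagonal_iff: "never_below_diagonal p \<longleftrightarrow> nonneg_from 0 p"
proof (induction p rule: rev_induct)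
  case Nil
  then show ?case by (simp add: never_below_diagonal_def vertices_Nil)
next
  case (snoc x p)
  have "never_below_diagonal (p @ [x]) \<longleftrightarrow> never_below_diagonal p \<and> 0 \<le> height (p @ [x])"
    unfolding never_below_diagonal_def vertices_snoc height_def by auto
  also have "\<dots> \<longleftrightarrow> nonneg_from 0 (p @ [x])"
    using snoc.IH by (cases x) (auto simp: nonneg_from_append dest: nonneg_from_end)
  finally show ?case .
qed

text \<open>Integer form of the squares inside \<open>region p\<close>, each named by its south-west
  corner; the antidiagonal is ignored here.\<close>

definition squares :: "step list \<Rightarrow> (nat \<times> nat) set" where
  "squares p = {(a, b). a < b \<and> (\<exists>(i, j)\<in>vertices p. i \<le> a \<and> b < j)}"

lemma endpoint_in_vertices: "(count_list p East, count_list p North) \<in> vertices p"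
  unfolding vertices_def by (rule image_eqI[of _ _ "length p"]) (auto simp: vertex_def)

lemma vertices_le_endpoint:
  assumes "(i, j) \<in> vertices p"
  shows "i \<le> count_list p East" "j \<le> count_list p North"
proof -
  obtain k where "i = count_list (take k p) East" "j = count_list (take k p) North"
    using assms by (auto simp: vertices_def vertex_def)
  moreover have "count_list (take k p) s \<le> count_list p s" for s
    by (metis append_take_drop_id count_list_append le_add1)
  ultimately show "i \<le> count_list p East" "j \<le> count_list p North"
    by auto
qed

lemma finite_squares: "finite (squares p)"
  by (rule finite_subset[of _ "{..<count_list p North} \<times> {..<count_list p North}"])
    (auto simp: squares_def dest!: vertices_le_endpoint(2))

text \<open>Induction from the end of the path: a north step from \<open>(i, j)\<close> adds the
  \<open>j - i\<close> squares of row \<open>j\<close> between the path and the diagonal, an east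
  step adds nothing.\<close>

lemma card_squares: "nonneg_from 0 p \<Longrightarrow> int (card (squares p)) = weight 0 p"
proof (induction p rule: rev_induct)
  case Nil
  then show ?case by (simp add: squares_def vertices_Nil)
next
  case (snoc x p)
  define i j where "i = count_list p East" and "j = count_list p North"
  have end_vertex: "(i, j) \<in> vertices p"
    unfolding i_def j_def by (rule endpoint_in_vertices)
  have bound: "j' \<le> j" if "(i', j') \<in> vertices p" for i' j'
    using vertices_le_endpoint[OF that] by (simp add: j_def)
  have p: "nonneg_from 0 p"
    using snoc.prems by (simp add: nonneg_from_append)
  then have "i \<le> j"
    using nonneg_from_end[of 0 p] by (simp add: height_def i_def j_def)
  show ?case
  proof (cases x)
    case North
    have "squares (p @ [x]) = squares p \<union> (\<lambda>a. (a, j)) ` {i..<j}"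
    proof (intro equalityI subsetI)
      fix s assume "s \<in> squares (p @ [x])"
      then obtain a b where s: "s = (a, b)" "a < b"
        and "(i \<le> a \<and> b < Suc j) \<or> (\<exists>(i', j')\<in>vertices p. i' \<le> a \<and> b < j')"
        by (auto simp: squares_def vertices_snoc North i_def j_def)
      \<comment> \<open>A square strictly below row \<open>j\<close> and right of \<open>i\<close>
        is already dominated by the old endpoint \<open>(i, j)\<close>.\<close>
      then show "s \<in> squares p \<union> (\<lambda>a. (a, j)) ` {i..<j}"
        using end_vertex by (cases "b = j") (auto simp: squares_def less_Suc_eq)
    qed (auto simp: squares_def vertices_snoc North i_def j_def)
    moreover have "squares p \<inter> (\<lambda>a. (a, j)) ` {i..<j} = {}"
      using bound by (fastforce simp: squares_def)
    moreover have "card ((\<lambda>a. (a, j)) ` {i..<j}) = j - i"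
      by (subst card_image) (auto simp: inj_on_def)
    ultimately have "card (squares (p @ [x])) = card (squares p) + (j - i)"
      by (simp add: card_Un_disjoint finite_squares)
    then show ?thesis
      using snoc.IH[OF p] \<open>i \<le> j\<close> by (simp add: North weight_append height_def i_def j_def)
  next
    case East
    have "squares (p @ [x]) = squares p"
      using end_vertex by (auto simp: squares_def vertices_snoc East i_def j_def intro: Suc_leD)
    then show ?thesis
      using snoc.IH[OF p] by (simp add: East weight_append)
  qed
qed

section \<open>From squares in the plane to pairs of integers\<close>

text \<open>Two corners decide: the south-east one forces \<open>a < b\<close>, and a vertex that
  dominates the north-west one dominates the whole square.\<close>

lemma unit_square_subset_region_iff: "unit_square a b \<subseteq> region p \<longleftrightarrow> (a, b) \<in> squares p"
proof
  assume *: "unit_square a b \<subseteq> region p"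
  have "(real a + 1, real b) \<in> region p" "(real a, real b + 1) \<in> region p"
    using * by (auto simp: unit_square_def)
  then obtain i j where "(i, j) \<in> vertices p" "real i \<le> real a" "real b + 1 \<le> real j"
    and "real a + 1 \<le> real b"
    by (auto simp: region_def)
  then have "i \<le> a \<and> b < j" "a < b"
    by linarith+
  with \<open>(i, j) \<in> vertices p\<close> show "(a, b) \<in> squares p"
    by (auto simp: squares_def)
next
  assume "(a, b) \<in> squares p"
  then obtain i j where "(i, j) \<in> vertices p" "i \<le> a" "b < j" "a < b"
    by (auto simp: squares_def)
  then have "(i, j) \<in> vertices p" "real i \<le> real a" "real b + 1 \<le> real j"
    and "real a + 1 \<le> real b"
    by linarith+
  then show "unit_square a b \<subseteq> region p"
    by (auto simp: region_def unit_square_def intro!: bexI[of _ "(i, j)"])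
qed

text \<open>The two deciding corners lie on the antidiagonal itself, so the lower half still
  contains them and the criterion is that of the full square.\<close>

lemma half_square_subset_region_iff:
  assumes "a + b + 1 = 2 * n"
  shows "unit_square a b \<inter> below_antidiagonal n \<subseteq> region_B n p \<longleftrightarrow> (a, b) \<in> squares p"
proof
  assume *: "unit_square a b \<inter> below_antidiagonal n \<subseteq> region_B n p"
  have "real a + real b + 1 = 2 * real n"
    using assms by linarith
  then have "(real a + 1, real b) \<in> region p" "(real a, real b + 1) \<in> region p"
    using * by (auto simp: unit_square_def region_B_def below_antidiagonal_def)
  then obtain i j where "(i, j) \<in> vertices p" "real i \<le> real a" "real b + 1 \<le> real j"
    and "real a + 1 \<le> real b"
    by (auto simp: region_def)
  then have "i \<le> a \<and> b < j" "a < b"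
    by linarith+
  with \<open>(i, j) \<in> vertices p\<close> show "(a, b) \<in> squares p"
    by (auto simp: squares_def)
next
  assume "(a, b) \<in> squares p"
  then show "unit_square a b \<inter> below_antidiagonal n \<subseteq> region_B n p"
    using unit_square_subset_region_iff[of a b p] by (auto simp: region_B_def)
qed

lemma unit_square_subset_below_antidiagonal_iff:
  "unit_square a b \<subseteq> below_antidiagonal n \<longleftrightarrow> a + b + 2 \<le> 2 * n"
proof
  assume *: "unit_square a b \<subseteq> below_antidiagonal n"
  have "(real a + 1, real b + 1) \<in> below_antidiagonal n"
    using * by (auto simp: unit_square_def)
  then show "a + b + 2 \<le> 2 * n"
    by (auto simp: below_antidiagonal_def)
next
  assume "a + b + 2 \<le> 2 * n"
  then have "real a + real b + 2 \<le> 2 * real n"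
    by linarith
  then show "unit_square a b \<subseteq> below_antidiagonal n"
    by (auto simp: unit_square_def below_antidiagonal_def)
qed

section \<open>Areas in terms of the weight\<close>

lemma area_eq: "nonneg_from 0 p \<Longrightarrow> int (area p) = weight 0 p"
  by (simp add: area_def unit_square_subset_region_iff card_squares)

text \<open>Full squares have \<open>a + b + 2 \<le> 2 * n\<close> and counted halves have
  \<open>a + b + 1 = 2 * n\<close>; together this is \<open>a + b < 2 * n\<close>.\<close>

lemma area_B_eq_card: "area_B n p = card (squares p \<inter> {(a, b). a + b < 2 * n})"
proof -
  have "(unit_square a b \<subseteq> region_B n p \<or>
      (a + b + 1 = 2 * n \<and> unit_square a b \<inter> below_antidiagonal n \<subseteq> region_B n p)) \<longleftrightarrow>
      (a, b) \<in> squares p \<and> a + b < 2 * n" for a b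
  proof -
    have "unit_square a b \<subseteq> region_B n p \<longleftrightarrow> (a, b) \<in> squares p \<and> a + b + 2 \<le> 2 * n"
      by (simp add: region_B_def unit_square_subset_region_iff
          unit_square_subset_below_antidiagonal_iff)
    moreover have "a + b < 2 * n \<longleftrightarrow> a + b + 2 \<le> 2 * n \<or> a + b + 1 = 2 * n"
      by linarith
    ultimately show ?thesis
      using half_square_subset_region_iff[of a b n p] by blast
  qed
  then have "{(a, b). unit_square a b \<subseteq> region_B n p \<or>
      (a + b + 1 = 2 * n \<and> unit_square a b \<inter> below_antidiagonal n \<subseteq> region_B n p)} =
      squares p \<inter> {(a, b). a + b < 2 * n}"
    by auto
  then show ?thesis
    by (simp only: area_B_def)
qed

text \<open>Counted by rows: with \<open>y\<close> the depth of row \<open>b\<close> below the top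
  row \<open>i + 2 * m - 1\<close>, the row holds \<open>2 * (m - 1 - y)\<close> squares.\<close>

lemma card_triangle_above_antidiagonal:
  "int (card {(a, b). i \<le> a \<and> a < b \<and> b < i + 2 * m \<and> 2 * i + 2 * m \<le> a + b}) =
     int m * (int m - 1)" (is "int (card ?T) = _")
proof -
  define A where "A = (SIGMA y:{..<m}. {i + y + 1..<i + 2 * m - 1 - y})"
  have "bij_betw (\<lambda>(y, a). (a, i + 2 * m - 1 - y)) A ?T"
    by (rule bij_betw_byWitness[where f' = "\<lambda>(a, b). (i + 2 * m - 1 - b, a)"])
      (auto simp: A_def)
  then have "card ?T = card A"
    by (simp add: bij_betw_same_card)
  also have "\<dots> = (\<Sum>y<m. 2 * (m - 1 - y))"
    unfolding A_def by (subst card_SigmaI) (auto intro!: sum.cong)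
  also have "\<dots> = (\<Sum>y<m. 2 * y)"
    by (subst sum.nat_diff_reindex[symmetric]) simp
  finally have "card ?T = (\<Sum>y<m. 2 * y)" .
  moreover have "int (\<Sum>y<m. 2 * y) = int m * (int m - 1)"
    by (induction m) (auto simp: algebra_simps)
  ultimately show ?thesis by simp
qed

text \<open>The weight also counts dominated squares beyond the antidiagonal. They form the triangle
  of the previous lemma, fixed by the endpoint \<open>(n - m, n + m)\<close>, and are
  subtracted.\<close>

lemma area_B_eq:
  assumes "nonneg_from 0 p" "length p = 2 * n"
  defines "m \<equiv> int n - int (count_list p East)"
  shows "int (area_B n p) = weight 0 p - m * (m - 1)" "height p = 2 * m" "0 \<le> m"
proof -
  define i where "i = count_list p East"
  have "0 \<le> height p"
    using nonneg_from_end[OF assms(1)] by simp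
  have length: "count_list p North + i = 2 * n"
    using assms(2) length_eq_count_steps[of p] by (simp add: i_def)
  then show height: "height p = 2 * m"
    by (simp add: height_def m_def i_def)
  with \<open>0 \<le> height p\<close> show "0 \<le> m"
    by simp
  then have "i \<le> n"
    by (simp add: m_def i_def)
  then have m: "m = int (n - i)"
    by (simp add: m_def i_def)
  have north: "count_list p North = i + 2 * (n - i)"
    using length \<open>i \<le> n\<close> by linarith
  \<comment> \<open>The endpoint has ordinate \<open>2 * n - i\<close>, so
    \<open>b < 2 * n - i\<close>; with \<open>2 * n \<le> a + b\<close> this forces
    \<open>i < a\<close>, and the endpoint alone dominates all these squares.\<close>
  have "squares p \<inter> {(a, b). 2 * n \<le> a + b} =
      {(a, b). i \<le> a \<and> a < b \<and> b < i + 2 * (n - i) \<and> 2 * i + 2 * (n - i) \<le> a + b}" (is "?L = ?R")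
  proof (intro equalityI subsetI)
    fix s assume "s \<in> ?L"
    then obtain a b where s: "s = (a, b)" "a < b" "2 * n \<le> a + b"
      and "\<exists>(i', j')\<in>vertices p. b < j'"
      by (auto simp: squares_def)
    then have "b < i + 2 * (n - i)"
      using vertices_le_endpoint(2) north by fastforce
    with s \<open>i \<le> n\<close> show "s \<in> ?R"
      by auto
  next
    fix s assume "s \<in> ?R"
    then show "s \<in> ?L"
      using endpoint_in_vertices[of p] \<open>i \<le> n\<close> north by (auto simp: squares_def i_def)
  qed
  then have "int (card (squares p \<inter> {(a, b). 2 * n \<le> a + b})) = m * (m - 1)"
    by (simp only: card_triangle_above_antidiagonal m)
  moreover have "card (squares p) = card (squares p \<inter> {(a, b). a + b < 2 * n}) +
      card (squares p \<inter> {(a, b). 2 * n \<le> a + b})"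
    by (subst card_Un_disjoint[symmetric])
      (auto simp: finite_squares intro!: arg_cong[where f = card])
  ultimately show "int (area_B n p) = weight 0 p - m * (m - 1)"
    using card_squares[OF assms(1)] by (simp add: area_B_eq_card)
qed

section \<open>The sets of paths, and Catalan paths without their final step\<close>

lemma catalan_paths_B_iff: "p \<in> catalan_paths_B n \<longleftrightarrow> length p = 2 * n \<and> nonneg_from 0 p"
  by (simp add: catalan_paths_B_def never_below_diagonal_iff)

lemma finite_catalan_paths_B: "finite (catalan_paths_B n)"
proof -
  have "set p \<subseteq> {North, East}" for p
    using step.exhaust by blast
  then have "catalan_paths_B n \<subseteq> {p. set p \<subseteq> {North, East} \<and> length p = 2 * n}"
    by (auto simp: catalan_paths_B_def)
  then show ?thesis
    by (rule finite_subset) (simp add: finite_lists_length_eq)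
qed

lemma catalan_paths_eq: "catalan_paths n = {p \<in> catalan_paths_B n. height p = 0}"
  by (auto simp: catalan_paths_def catalan_paths_B_def height_def length_eq_count_steps)

text \<open>For \<open>n \<ge> 1\<close> these are the Catalan paths with the final east step
  removed, the shape of the piece before the cut; for \<open>n = 0\<close> there are none.\<close>

definition open_paths :: "nat \<Rightarrow> step list set" where
  "open_paths n = {c. length c + 1 = 2 * n \<and> nonneg_from 0 c \<and> height c = 1}"

text \<open>A final north step would have to start at height -1, so a nonempty Catalan path ends
  with an east step, which carries no weight.\<close>

lemma Cat_eq_sum_open_paths:
  assumes "n \<ge> 1"
  shows "Cat n = (\<Sum>c\<in>open_paths n. monom 1 (nat (weight 0 c)))"
proof -
  have "bij_betw (\<lambda>c. c @ [East]) (open_paths n) (catalan_paths n)"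
  proof (rule bij_betw_imageI)
    show "(\<lambda>c. c @ [East]) ` open_paths n = catalan_paths n"
    proof (intro equalityI subsetI)
      fix p assume p: "p \<in> catalan_paths n"
      then have "p \<noteq> []"
        using assms by (auto simp: catalan_paths_def)
      then obtain c x where "p = c @ [x]"
        by (metis append_butlast_last_id)
      with p have "p = c @ [East]" "c \<in> open_paths n"
        by (cases x; auto simp: catalan_paths_eq catalan_paths_B_iff open_paths_def
            nonneg_from_append dest: nonneg_from_end)+
      then show "p \<in> (\<lambda>c. c @ [East]) ` open_paths n"
        by blast
    qed (auto simp: catalan_paths_eq catalan_paths_B_iff open_paths_def nonneg_from_append)
  qed (auto simp: inj_on_def)
  then have "Cat n = (\<Sum>c\<in>open_paths n. monom 1 (area (c @ [East])))"
    by (simp add: Cat_def sum.reindex_bij_betw[symmetric])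
  also have "\<dots> = (\<Sum>c\<in>open_paths n. monom 1 (nat (weight 0 c)))"
  proof (intro sum.cong refl)
    fix c assume "c \<in> open_paths n"
    then have "int (area (c @ [East])) = weight 0 c"
      by (subst area_eq) (auto simp: open_paths_def nonneg_from_append weight_append)
    then have "area (c @ [East]) = nat (weight 0 c)"
      by linarith
    then show "monom (1 :: int) (area (c @ [East])) = monom 1 (nat (weight 0 c))"
      by simp
  qed
  finally show ?thesis .
qed

section \<open>Cutting at the last step from height 1 to height 2\<close>

text \<open>Induction from the end: if height 2 was reached before the last step, the old cut
  survives and \<open>s\<close> grows by \<open>x\<close>; otherwise \<open>x\<close> is itself the
  cut step.\<close>

lemma ex_last_step_to_2:
  "2 \<le> height p \<Longrightarrow> \<exists>c s. p = c @ North # s \<and> height c = 1 \<and> nonneg_from 0 s"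
proof (induction p rule: rev_induct)
  case (snoc x p)
  show ?case
  proof (cases "2 \<le> height p")
    case True
    then obtain c s where cs: "p = c @ North # s" "height c = 1" "nonneg_from 0 s"
      using snoc.IH by blast
    \<comment> \<open>The whole path ends at height at least 2 and \<open>s\<close> starts at height
      2, so the longer suffix ends at or above its start.\<close>
    have "nonneg_from 0 (s @ [x])"
      using cs snoc.prems by (cases x) (auto simp: nonneg_from_append dest: nonneg_from_end)
    with cs show ?thesis by (intro exI[of _ c] exI[of _ "s @ [x]"]) simp
  next
    case False
    with snoc.prems have "x = North" "height p = 1"
      by (cases x; auto)+
    then show ?thesis by (intro exI[of _ p] exI[of _ "[]"]) simp
  qed
qed simp

text \<open>If one cut came later, the stretch \<open>v\<close> between the earlier cut step and the
  later one would descend by 1 while being a prefix of the nonnegative suffix.\<close>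

lemma last_step_to_2_unique:
  assumes "c @ North # s = c' @ North # s'" "height c = 1" "height c' = 1"
    and "nonneg_from 0 s" "nonneg_from 0 s'"
  shows "c = c'" "s = s'"
proof -
  have *: "u = []" if "c2 = c1 @ u" "North # s1 = u @ North # s2"
    "height c1 = 1" "height c2 = 1" "nonneg_from 0 s1" for u c1 c2 s1 s2
  proof (cases u)
    case (Cons x v)
    with that have "height v = -1" "nonneg_from 0 v"
      by (auto simp: nonneg_from_append)
    then show ?thesis
      using nonneg_from_end[of 0 v] by simp
  qed
  from assms(1) obtain u where "c = c' @ u \<and> u @ North # s = North # s' \<or>
      c @ u = c' \<and> North # s = u @ North # s'"
    by (auto simp: append_eq_append_conv2)
  then have "c = c'"
  proof
    assume "c = c' @ u \<and> u @ North # s = North # s'"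
    with *[of c c' u s' s] assms show ?thesis by fastforce
  next
    assume "c @ u = c' \<and> North # s = u @ North # s'"
    with *[of c' c u s s'] assms show ?thesis by fastforce
  qed
  with assms(1) show "c = c'" "s = s'"
    by auto
qed

text \<open>Existence and uniqueness of the cut give surjectivity and injectivity; the index
  \<open>k\<close> is recovered as half the length of \<open>s\<close>.\<close>

lemma bij_betw_open_paths:
  "bij_betw (\<lambda>(k, s, c). c @ North # s)
     (SIGMA k:{..<n}. catalan_paths_B k \<times> open_paths (n - k))
     {p \<in> catalan_paths_B n. height p \<noteq> 0}" (is "bij_betw ?f ?A ?B")
proof (rule bij_betw_imageI)
  show "inj_on ?f ?A"
  proof (rule inj_onI)
    fix x y assume xy: "x \<in> ?A" "y \<in> ?A" "?f x = ?f y"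
    obtain k s c k' s' c' where eq: "x = (k, s, c)" "y = (k', s', c')"
      by (metis prod_cases3)
    have "c = c'" "s = s'"
      using last_step_to_2_unique[of c s c' s'] xy
      by (auto simp: eq catalan_paths_B_iff open_paths_def)
    with xy show "x = y"
      by (auto simp: eq catalan_paths_B_iff)
  qed
  show "?f ` ?A = ?B"
  proof (intro equalityI subsetI)
    fix p assume "p \<in> ?f ` ?A"
    then obtain k s c where *: "p = c @ North # s" "k < n" "length s = 2 * k" "nonneg_from 0 s"
      "length c + 1 = 2 * (n - k)" "nonneg_from 0 c" "height c = 1"
      by (auto simp: catalan_paths_B_iff open_paths_def)
    moreover from * have "nonneg_from 2 s" "0 \<le> height s"
      using nonneg_from_end[of 0 s] by (auto intro: nonneg_from_mono)
    ultimately show "p \<in> ?B"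
      by (auto simp: catalan_paths_B_iff nonneg_from_append)
  next
    fix p assume "p \<in> ?B"
    then have p: "length p = 2 * n" "nonneg_from 0 p" "height p \<noteq> 0"
      by (auto simp: catalan_paths_B_iff)
    \<comment> \<open>An even length makes the final height even, so leaving the diagonal means
      ending at height at least 2.\<close>
    obtain m where "height p = 2 * m" "0 \<le> m"
      using area_B_eq(2,3)[OF p(2,1)] by blast
    with p(3) have "2 \<le> height p"
      by simp
    then obtain c s where cs: "p = c @ North # s" "height c = 1" "nonneg_from 0 s"
      using ex_last_step_to_2 by blast
    \<comment> \<open>Height 1 makes the length of \<open>c\<close> odd, so the rest after the cut
      step has even length.\<close>
    have "odd (length c)"
    proof -
      have "int (length c) = 1 + 2 * int (count_list c East)"
        using cs(2) by (simp add: length_eq_count_steps height_def)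
      then show ?thesis by presburger
    qed
    then obtain l where l: "length c = 2 * l + 1"
      by (elim oddE)
    define k where "k = n - l - 1"
    have "k < n" "length s = 2 * k" "length c + 1 = 2 * (n - k)"
      using p(1) cs(1) l unfolding k_def by auto
    then have "(k, s, c) \<in> ?A"
      using cs p(2) by (auto simp: catalan_paths_B_iff open_paths_def nonneg_from_append)
    then show "p \<in> ?f ` ?A"
      using cs(1) by (intro image_eqI[of _ _ "(k, s, c)"]) auto
  qed
qed

section \<open>Additivity of the area under the cut, and the recurrence\<close>

lemma weight_nonneg: "nonneg_from d p \<Longrightarrow> 0 \<le> weight d p"
  by (induction d p rule: nonneg_from.induct) auto

text \<open>The cut step weighs 1, and raising \<open>s\<close> by 2 adds 2 for each of its
  \<open>k + m\<close> north steps. The subtracted triangle grows from \<open>m * (m - 1)\<close> to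
  \<open>(m + 1) * m\<close>, that is by \<open>2 * m\<close>, which leaves
  \<open>2 * k + 1\<close>.\<close>

lemma area_B_decompose:
  assumes "k < n" "s \<in> catalan_paths_B k" "c \<in> open_paths (n - k)"
  shows "area_B n (c @ North # s) = 2 * k + 1 + area_B k s + nat (weight 0 c)"
proof -
  define p where "p = c @ North # s"
  have s: "length s = 2 * k" "nonneg_from 0 s"
    using assms(2) by (auto simp: catalan_paths_B_iff)
  have c: "length c + 1 = 2 * (n - k)" "nonneg_from 0 c" "height c = 1"
    using assms(3) by (auto simp: open_paths_def)
  have "nonneg_from 2 s"
    using s(2) by (rule nonneg_from_mono) simp
  then have p: "nonneg_from 0 p" "length p = 2 * n"
    using s c assms(1) by (auto simp: p_def nonneg_from_append)
  define m where "m = int k - int (count_list s East)"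
  have "2 * int (count_list c East) + 1 = int (length c)"
    using c(3) by (simp add: height_def length_eq_count_steps)
  then have m: "int n - int (count_list p East) = m + 1"
    using c(1) assms(1) by (simp add: p_def m_def)
  have north: "int (count_list s North) = int k + m"
    using s(1) length_eq_count_steps[of s] by (simp add: m_def)
  have "weight 0 p = weight 0 c + 1 + weight 0 s + 2 * (int k + m)"
    using weight_shift[of 0 2 s] c(3) north by (simp add: p_def weight_append)
  then have "int (area_B n p) = weight 0 c + 1 + weight 0 s + 2 * (int k + m) - (m + 1) * m"
    using area_B_eq(1)[OF p] m by simp
  moreover have "int (area_B k s) = weight 0 s - m * (m - 1)"
    using area_B_eq(1)[OF s(2,1)] by (simp add: m_def)
  ultimately have "int (area_B n p) = 2 * int k + 1 + int (area_B k s) + weight 0 c"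
    by (simp add: algebra_simps)
  then show ?thesis
    using weight_nonneg[OF c(2)] by (simp add: p_def)
qed

theorem theorem2:
  fixes n :: nat
  assumes "n \<ge> 1"
  shows "Cat_B n = Cat n + (\<Sum>k=0..n-1. monom 1 (2 * k + 1) * Cat_B k * Cat (n - k))"
proof -
  let ?w = "\<lambda>p. monom (1 :: int) (area_B n p)"
  let ?A = "SIGMA k:{..<n}. catalan_paths_B k \<times> open_paths (n - k)"
  have "finite (open_paths m)" for m
  proof -
    have "(\<lambda>c. c @ [East]) ` open_paths m \<subseteq> catalan_paths_B m"
      by (auto simp: catalan_paths_B_iff open_paths_def nonneg_from_append)
    then show ?thesis
      by (rule inj_on_finite[rotated, OF _ finite_catalan_paths_B]) (simp add: inj_on_def)
  qed
  note finite = this finite_catalan_paths_B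
  \<comment> \<open>Split by whether the path ends on the diagonal.\<close>
  have "Cat_B n = (\<Sum>p\<in>catalan_paths n. ?w p) +
      (\<Sum>p\<in>{p \<in> catalan_paths_B n. height p \<noteq> 0}. ?w p)"
    unfolding Cat_B_def catalan_paths_eq
    by (subst sum.union_disjoint[symmetric]) (auto simp: finite intro!: sum.cong)
  also have "(\<Sum>p\<in>catalan_paths n. ?w p) = Cat n"
    unfolding Cat_def
  proof (intro sum.cong refl)
    fix p assume "p \<in> catalan_paths n"
    then have p: "nonneg_from 0 p" "length p = 2 * n" "height p = 0"
      by (auto simp: catalan_paths_eq catalan_paths_B_iff)
    \<comment> \<open>Final height 0 means \<open>m = 0\<close> in \<open>area_B_eq\<close>, so
      nothing is subtracted.\<close>
    then have "area_B n p = area p"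
      using area_B_eq[OF p(1,2)] area_eq[OF p(1)] by simp
    then show "?w p = monom 1 (area p)"
      by simp
  qed
  also have "(\<Sum>p\<in>{p \<in> catalan_paths_B n. height p \<noteq> 0}. ?w p) =
      (\<Sum>(k, s, c)\<in>?A. ?w (c @ North # s))"
    by (subst sum.reindex_bij_betw[OF bij_betw_open_paths, symmetric]) (simp add: case_prod_unfold)
  also have "\<dots> = (\<Sum>k<n. \<Sum>s\<in>catalan_paths_B k. \<Sum>c\<in>open_paths (n - k). ?w (c @ North # s))"
    by (simp add: sum.Sigma sum.cartesian_product finite)
  also have "\<dots> = (\<Sum>k<n. monom 1 (2 * k + 1) * Cat_B k * Cat (n - k))"
  proof (intro sum.cong refl)
    fix k assume "k \<in> {..<n}"
    then have k: "k < n" by simp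
    have "(\<Sum>s\<in>catalan_paths_B k. \<Sum>c\<in>open_paths (n - k). ?w (c @ North # s)) =
        (\<Sum>s\<in>catalan_paths_B k. \<Sum>c\<in>open_paths (n - k).
          monom 1 (2 * k + 1) * (monom 1 (area_B k s) * monom 1 (nat (weight 0 c))))"
      by (intro sum.cong refl) (simp add: area_B_decompose[OF k] mult_monom ac_simps)
    \<comment> \<open>Here \<open>k < n\<close> gives \<open>n - k \<ge> 1\<close>, as
      \<open>Cat_eq_sum_open_paths\<close> requires.\<close>
    also have "\<dots> = monom 1 (2 * k + 1) * Cat_B k * Cat (n - k)"
      using k
      by (simp add: Cat_B_def Cat_eq_sum_open_paths mult.assoc sum_product flip: sum_distrib_left)
    finally show "(\<Sum>s\<in>catalan_paths_B k. \<Sum>c\<in>open_paths (n - k). ?w (c @ North # s)) =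
        monom 1 (2 * k + 1) * Cat_B k * Cat (n - k)" .
  qed
  also have "{..<n} = {0..n - 1}"
    using assms by auto
  finally show ?thesis .
qed

end
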